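(* Let $q$ be a prime power and let $k\ge6$ and $m$ be even positive integers. Let $S$ be an $i$-dimensional $\mathbb{F}_q$-subspace of $\mathbb{F}_{q^m}$ and let \[U_1=\{(x+\zeta,x^q,x^{q^2},0,\ldots,0) : x\in\mathbb{F}_{q^m},\ \zeta\in S\}\subseteq\mathbb{F}_{q^m}^k.\] Let $U_2$ be an $\mathbb{F}_q$-subspace of the $\mathbb{F}_{q^m}$-subspace $\{(x_0,\ldots,x_{k-1}) : x_0=x_1=x_2=0\}$ such that $L_{U_2}$ is a maximum scattered $\mathbb{F}_q$-linear set in the projective subspace of $\mathrm{PG}(k-1,q^m)$ with equations $X_0=X_1=X_2=0$. Then $U=U_1+U_2$ defines an $i$-club $L_U$ in $\mathrm{PG}(k-1,q^m)$ of rank $\frac{m(k-1)}{2}+i$. Moreover, if $m/2\le i\le m-3$, then $L_U$ is not $\Gamma\mathrm{L}(k,q^m)$-equivalent to any $i$-club of the following form: $L_{U'+U''}$ where $U'\subseteq W$ for a $(k-1)$-dimensional $\mathbb{F}_{q^m}$-subspace $W$ with $L_{U'}$ maximum scattered in $\mathrm{PG}(W,\mathbb{F}_{q^m})$, and $U''$ is an $i$-dimensional $\mathbb{F}_q$-subspace of $\langle x\rangle_{\mathbb{F}_{q^m}}$ for some $x$ with $\langle x\rangle_{\mathbb{F}_{q^m}}\cap W=\{0\}$.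
   Context: For an $\mathbb{F}_q$-subspace $U$ of $\mathbb{F}_{q^m}^k$, $L_U=\{\langle u\rangle_{\mathbb{F}_{q^m}} : u\in U\setminus\{0\}\}$ has rank $\dim_{\mathbb{F}_q}U$; the weight of a point $\langle v\rangle_{\mathbb{F}_{q^m}}$ is $\dim_{\mathbb{F}_q}(U\cap\langle v\rangle_{\mathbb{F}_{q^m}})$. $L_U$ is scattered if all its points have weight $1$; an $i$-club if exactly one point has weight $i$ and all others weight $1$. For an $r$-dimensional $\mathbb{F}_{q^m}$-subspace $W$, $L_{U'}$ with $U'\subseteq W$ is maximum scattered in $\mathrm{PG}(W,\mathbb{F}_{q^m})$ if it is scattered and $\dim_{\mathbb{F}_q}U'=rm/2$. Linear sets $L_U,L_{\bar U}$ are $\Gamma\mathrm{L}(k,q^m)$-equivalent if there exist $A\in\mathrm{GL}(k,q^m)$ and a field automorphism $\sigma$ of $\mathbb{F}_{q^m}$ with $\bar U=\{A(u^\sigma): u\in U\}$ ($\sigma$ applied coordinatewise).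
   Formalization: The dimension i of S is assumed to be at least 1 (for i=0 the set L_U is scattered, so it has no point of weight 0), and for i=1 "i-club" is read as one point of weight 1 and all others of weight 1, i.e. scattered, rather than literally exactly one point of weight 1. *)

theory Defs
  imports "HOL-Analysis.Analysis"
begin

definition field_hom :: "('a::field \<Rightarrow> 'b::field) \<Rightarrow> bool" where
  "field_hom h \<longleftrightarrow> h 1 = 1 \<and> (\<forall>x y. h (x + y) = h x + h y) \<and> (\<forall>x y. h (x * y) = h x * h y)"

definition field_aut :: "('a::field \<Rightarrow> 'a) \<Rightarrow> bool" where
  "field_aut \<sigma> \<longleftrightarrow> field_hom \<sigma> \<and> bij \<sigma>"

text \<open>
  The field extension is given by an embedding \<open>h\<close> of the small field \<open>'f\<close> (of order \<open>q\<close>) into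
  the big field \<open>'a\<close> (of order \<open>q ^ m\<close>). Linear algebra over \<open>'f\<close> is that of the library locale
  \<open>vector_space\<close>, for the scalar multiplication restricted along \<open>h\<close>; linear algebra over \<open>'a\<close>
  is the library interpretation \<open>vec\<close>.
\<close>

definition sub_scale :: "('f::field \<Rightarrow> 'a::field) \<Rightarrow> 'f \<Rightarrow> 'a ^ 'k \<Rightarrow> 'a ^ 'k" where
  "sub_scale h c v = h c *s v"

definition sub_subspace :: "('f::field \<Rightarrow> 'a::field) \<Rightarrow> ('a ^ 'k) set \<Rightarrow> bool" where
  "sub_subspace h U \<longleftrightarrow> module.subspace (sub_scale h) U"

definition sub_dim :: "('f::field \<Rightarrow> 'a::field) \<Rightarrow> ('a ^ 'k) set \<Rightarrow> nat" where
  "sub_dim h U = vector_space.dim (sub_scale h) U"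

definition linear_set :: "('a::field ^ 'k) set \<Rightarrow> ('a ^ 'k) set set" where
  "linear_set U = {vec.span {u} | u. u \<in> U - {0}}"

definition weight :: "('f::field \<Rightarrow> 'a::field) \<Rightarrow> ('a ^ 'k) set \<Rightarrow> ('a ^ 'k) set \<Rightarrow> nat" where
  "weight h U P = sub_dim h (U \<inter> P)"

definition scattered :: "('f::field \<Rightarrow> 'a::field) \<Rightarrow> ('a ^ 'k) set \<Rightarrow> bool" where
  "scattered h U \<longleftrightarrow> sub_subspace h U \<and> (\<forall>P\<in>linear_set U. weight h U P = 1)"

text \<open>For \<open>i \<noteq> 1\<close> the point \<open>P\<close> is the only one of weight \<open>i\<close>; for \<open>i = 1\<close> the
  condition degenerates to being scattered (and nonempty).\<close>

definition is_club :: "('f::field \<Rightarrow> 'a::field) \<Rightarrow> nat \<Rightarrow> ('a ^ 'k) set \<Rightarrow> bool" where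
  "is_club h i U \<longleftrightarrow> sub_subspace h U \<and>
     (\<exists>P\<in>linear_set U. weight h U P = i \<and> (\<forall>Q\<in>linear_set U. Q \<noteq> P \<longrightarrow> weight h U Q = 1))"

text \<open>\<open>m\<close> is the degree of the extension; the last conjunct says that the rank is \<open>r m / 2\<close>
  where \<open>r\<close> is the dimension of \<open>W\<close> over the big field.\<close>

definition max_scattered_in ::
  "('f::field \<Rightarrow> 'a::field) \<Rightarrow> nat \<Rightarrow> ('a ^ 'k) set \<Rightarrow> ('a ^ 'k) set \<Rightarrow> bool" where
  "max_scattered_in h m W U \<longleftrightarrow>
     vec.subspace W \<and> U \<subseteq> W \<and> scattered h U \<and> 2 * sub_dim h U = vec.dim W * m"

definition GammaL_equivalent :: "('a::field ^ 'k) set \<Rightarrow> ('a ^ 'k) set \<Rightarrow> bool" where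
  "GammaL_equivalent U V \<longleftrightarrow>
     (\<exists>(A :: 'a ^ 'k ^ 'k) \<sigma>. invertible A \<and> field_aut \<sigma> \<and> V = (\<lambda>u. A *v (\<chi> j. \<sigma> (u $ j))) ` U)"

end

theory Submission
  imports Defs "HOL-Computational_Algebra.Polynomial"
begin

text \<open>
  A multiple \<open>l u\<close> of \<open>u \<in> U\<close> outside the first coordinate axis that lies in \<open>U\<close> has
  \<open>l\<close> in the small field: either the component of \<open>u\<close> in \<open>U2\<close> is nonzero and \<open>U2\<close> is
  scattered, or \<open>l = t\<^sup>q\<close> and \<open>l = (t\<^sup>q)\<^sup>q\<close> for some \<open>t\<close>, whence \<open>l\<^sup>q = l\<close>.
  So the only heavy point is the first axis, which meets \<open>U\<close> in \<open>S\<close>.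

  An equivalence with a split club \<open>U' + U''\<close> maps this heavy point to the one containing \<open>U''\<close>.
  The equation of the hyperplane containing \<open>U'\<close>, pulled back to \<open>U\<close>, then shows that
  some map \<open>y \<mapsto> d\<^sub>0 y + d\<^sub>1 y\<^sup>q + d\<^sub>2 (y\<^sup>q)\<^sup>q\<close> with \<open>d\<^sub>0 \<noteq> 0\<close> takes at most \<open>card S = q\<^sup>i\<close>
  values. Its fibres have at most \<open>q\<^sup>2\<close> elements, so \<open>m \<le> i + 2\<close>.
\<close>

section \<open>Homomorphisms between fields\<close>

lemma field_hom_simps:
  assumes "field_hom h"
  shows "h (x + y) = h x + h y" "h (x * y) = h x * h y" "h 1 = 1" "h 0 = 0"
proof -
  show *: "h (x + y) = h x + h y" "h (x * y) = h x * h y" "h 1 = 1" for x y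
    using assms by (auto simp: field_hom_def)
  show "h 0 = 0"
    using *(1)[of 0 0] by (metis add_cancel_right_right add_0)
qed

lemma field_hom_power: "field_hom h \<Longrightarrow> h (x ^ n) = h x ^ n"
  by (induction n) (simp_all add: field_hom_simps)

lemma field_hom_minus: "field_hom h \<Longrightarrow> h (- x) = - h x"
  by (metis add.right_inverse field_hom_simps(1,4) minus_unique)

lemma field_hom_diff: "field_hom h \<Longrightarrow> h (x - y) = h x - h y"
  by (metis diff_conv_add_uminus field_hom_minus field_hom_simps(1))

lemma field_hom_eq_0_iff: "field_hom h \<Longrightarrow> h x = 0 \<longleftrightarrow> x = 0"
  by (metis field_hom_simps(2,3,4) mult_zero_left right_inverse zero_neq_one)

lemma field_hom_inj: "field_hom h \<Longrightarrow> inj h"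
  by (metis (no_types, lifting) field_hom_diff field_hom_eq_0_iff injI right_minus_eq)

lemma card_range_field_hom:
  fixes h :: "'f::{field,finite} \<Rightarrow> 'a::field"
  shows "field_hom h \<Longrightarrow> card (range h) = CARD('f)"
  by (simp add: card_image field_hom_inj)

lemma card_field_ge_2: "CARD('f::{field,finite}) \<ge> 2"
  using card_mono[of "UNIV :: 'f set" "{0, 1}"] by simp

section \<open>The \<open>q\<close>-power map and its fixed elements\<close>

text \<open>Multiplication by a nonzero \<open>x\<close> permutes the nonzero elements; comparing
  their product before and after gives \<open>x ^ (CARD('f) - 1) = 1\<close>.\<close>

lemma finite_field_power_CARD:
  fixes x :: "'f::{field,finite}"
  shows "x ^ CARD('f) = x"
proof (cases "x = 0")
  case True
  then show ?thesis using card_field_ge_2[where 'f = 'f] by simp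
next
  case False
  let ?P = "\<Prod>(UNIV - {0::'f})"
  have "bij_betw ((*) x) (UNIV - {0}) (UNIV - {0})"
    using False by (intro bij_betw_byWitness[where f' = "\<lambda>y. y / x"]) auto
  then have "(\<Prod>y\<in>UNIV - {0}. x * y) = ?P"
    by (rule prod.reindex_bij_betw)
  then have "x ^ (CARD('f) - 1) * ?P = 1 * ?P"
    by (simp add: prod.distrib)
  then have "x ^ (CARD('f) - 1) = 1"
    by (subst (asm) mult_cancel_right) simp
  then have "x * x ^ (CARD('f) - 1) = x"
    by simp
  then show ?thesis
    by (metis power_eq_if zero_less_card_finite less_irrefl)
qed

lemma power_card_range_field_hom:
  fixes h :: "'f::{field,finite} \<Rightarrow> 'a::field"
  assumes "field_hom h" "x \<in> range h"
  shows "x ^ CARD('f) = x"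
  using assms finite_field_power_CARD field_hom_power by (metis rangeE)

text \<open>The polynomial \<open>X^q - X\<close> has at most \<open>q\<close> roots, and the image
  of the small field already supplies \<open>q\<close> of them. This is how scalars are recognised
  as lying in the small field.\<close>

lemma power_card_eq_self_iff:
  fixes h :: "'f::{field,finite} \<Rightarrow> 'a::field"
  assumes h: "field_hom h"
  shows "x ^ CARD('f) = x \<longleftrightarrow> x \<in> range h"
proof -
  let ?q = "CARD('f)"
  let ?p = "monom (1::'a) ?q - monom 1 1"
  have q: "?q \<ge> 2" by (rule card_field_ge_2)
  have "coeff ?p ?q = 1" using q by simp
  then have p: "?p \<noteq> 0" by (metis coeff_0 zero_neq_one)
  have eq: "{x. poly ?p x = 0} = {x. x ^ ?q = x}"
    by (auto simp: poly_monom)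
  have "degree ?p \<le> ?q"
    using q by (intro degree_diff_le degree_monom_le order.trans[OF degree_monom_le]) auto
  then have "card {x::'a. x ^ ?q = x} \<le> ?q"
    using card_poly_roots_bound[OF p] unfolding eq by linarith
  moreover have "finite {x::'a. x ^ ?q = x}"
    using poly_roots_finite[OF p] unfolding eq .
  moreover have "range h \<subseteq> {x. x ^ ?q = x}"
    using power_card_range_field_hom[OF h] by auto
  ultimately have "range h = {x. x ^ ?q = x}"
    by (intro card_seteq) (simp_all add: card_range_field_hom[OF h])
  then show ?thesis by auto
qed

text \<open>The polynomial \<open>(X + c)\<^sup>q - X\<^sup>q - c\<^sup>q\<close> has degree less than \<open>q\<close>,
  so it vanishes identically as soon as it does on the \<open>q\<close> elements of the small field.
  Used twice, this gives the additivity of \<open>x \<mapsto> x\<^sup>q\<close> without recourse to the characteristic.\<close>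

lemma power_card_add_aux:
  fixes h :: "'f::{field,finite} \<Rightarrow> 'a::field"
  assumes h: "field_hom h"
    and c: "\<And>b. b \<in> range h \<Longrightarrow> (b + c) ^ CARD('f) = b ^ CARD('f) + c ^ CARD('f)"
  shows "(x + c) ^ CARD('f) = x ^ CARD('f) + c ^ CARD('f)"
proof -
  let ?q = "CARD('f)"
  let ?p = "[:c, 1:] ^ ?q - monom 1 ?q - [:c ^ ?q:]"
  have q: "?q \<ge> 2" by (rule card_field_ge_2)
  have poly: "poly ?p y = (y + c) ^ ?q - y ^ ?q - c ^ ?q" for y
    by (simp add: poly_monom add.commute)
  have "?p = 0"
  proof (rule ccontr)
    assume p: "?p \<noteq> 0"
    have "degree ?p \<le> ?q"
      by (intro degree_diff_le degree_monom_le) (auto simp: degree_linear_power)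
    moreover have "coeff ?p ?q = 0"
      using q by (simp add: coeff_linear_power coeff_pCons split: nat.split)
    ultimately have "degree ?p < ?q"
      using p by (metis le_neq_implies_less leading_coeff_0_iff)
    moreover have "?q \<le> card {y. poly ?p y = 0}"
      using c poly by (subst card_range_field_hom[OF h, symmetric], intro card_mono poly_roots_finite p)
        (auto simp del: poly_diff)
    ultimately show False
      using card_poly_roots_bound[OF p] by linarith
  qed
  then show ?thesis
    using poly[of x] by (simp add: algebra_simps)
qed

lemma power_card_add:
  fixes h :: "'f::{field,finite} \<Rightarrow> 'a::field"
  assumes h: "field_hom h"
  shows "(x + y) ^ CARD('f) = x ^ CARD('f) + (y :: 'a) ^ CARD('f)"
proof (rule power_card_add_aux[OF h])
  fix b assume b: "b \<in> range h"
  have "(y + b) ^ CARD('f) = y ^ CARD('f) + b ^ CARD('f)"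
  \<comment> \<open>Now the small-field element \<open>b\<close> is the constant and
    \<open>y\<close> the variable. The remaining case has both summands in the small field, where
    the \<open>q\<close>-power map is the identity.\<close>
  proof (rule power_card_add_aux[OF h])
    fix a assume a: "a \<in> range h"
    then have "a + b \<in> range h"
      using b h by (metis field_hom_simps(1) rangeE rangeI)
    then show "(a + b) ^ CARD('f) = a ^ CARD('f) + b ^ CARD('f)"
      using a b by (simp add: power_card_range_field_hom[OF h])
  qed
  then show "(b + y) ^ CARD('f) = b ^ CARD('f) + y ^ CARD('f)"
    by (simp add: add.commute)
qed

section \<open>Dimensions and weights by counting\<close>

text \<open>Coordinates with respect to a basis \<open>B\<close> identify \<open>V\<close> with the
  functions from \<open>B\<close> to the scalars. Ranks and weights can then be compared through
  cardinalities.\<close>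

lemma (in vector_space) card_subspace:
  assumes "subspace V" "finite V" and fin: "finite (UNIV :: 'a set)"
  shows "card V = CARD('a) ^ dim V"
proof -
  obtain B where B: "B \<subseteq> V" "independent B" "V \<subseteq> span B" "card B = dim V"
    using basis_exists by blast
  have fB: "finite B" using B(1) assms(2) finite_subset by blast
  have V: "V = span B"
    using B assms(1) by (simp add: span_minimal subset_antisym)
  let ?f = "\<lambda>u. \<Sum>v\<in>B. u v *s v"
  have inj: "inj_on ?f (B \<rightarrow>\<^sub>E UNIV)"
  proof (rule inj_onI)
    fix u w assume u: "u \<in> B \<rightarrow>\<^sub>E UNIV" and w: "w \<in> B \<rightarrow>\<^sub>E UNIV" and eq: "?f u = ?f w"
    then have "(\<Sum>v\<in>B. (u v - w v) *s v) = 0"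
      by (simp add: scale_left_diff_distrib sum_subtractf)
    then have "u v - w v = 0" if "v \<in> B" for v
      using independentD[OF B(2) fB order.refl, of "\<lambda>v. u v - w v"] that by blast
    then show "u = w"
      using u w by (intro PiE_ext[OF u w]) simp
  qed
  have "?f ` (B \<rightarrow>\<^sub>E UNIV) = V"
  proof -
    \<comment> \<open>Restricting a coefficient function to \<open>B\<close> does not change the
      sum; the extensional functions are used because only they are determined by their values on
      \<open>B\<close>.\<close>
    have "?f u \<in> ?f ` (B \<rightarrow>\<^sub>E UNIV)" for u
      by (intro image_eqI[where x = "restrict u B"]) (auto intro: sum.cong)
    then show ?thesis
      unfolding V span_finite[OF fB] by blast
  qed
  then have "card V = card (B \<rightarrow>\<^sub>E (UNIV :: 'a set))"
    using card_image[OF inj] by simp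
  then show ?thesis
    using fB B(4) by (simp add: card_PiE)
qed

lemma vector_space_sub_scale:
  "field_hom h \<Longrightarrow> vector_space (sub_scale h :: _ \<Rightarrow> 'a::field ^ 'k \<Rightarrow> _)"
  by unfold_locales
    (simp_all add: sub_scale_def field_hom_simps vec.scale_right_distrib vec.scale_left_distrib)

lemma vector_space_field_hom:
  "field_hom h \<Longrightarrow> vector_space (\<lambda>c x. h c * x)"
  by unfold_locales (simp_all add: field_hom_simps algebra_simps)

lemma sub_subspace_iff:
  assumes "field_hom h"
  shows "sub_subspace h U \<longleftrightarrow> 0 \<in> U \<and> (\<forall>u\<in>U. \<forall>v\<in>U. u + v \<in> U) \<and> (\<forall>c. \<forall>u\<in>U. h c *s u \<in> U)"
  unfolding sub_subspace_def
  by (subst module.subspace_def)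
    (use vector_space_sub_scale[OF assms] in \<open>auto simp: module_iff_vector_space sub_scale_def\<close>)

lemma card_sub_subspace:
  fixes h :: "'f::{field,finite} \<Rightarrow> 'a::{field,finite}" and U :: "('a ^ 'k::finite) set"
  assumes "field_hom h" "sub_subspace h U"
  shows "card U = CARD('f) ^ sub_dim h U"
  using vector_space.card_subspace[OF vector_space_sub_scale[OF assms(1)], of U] assms(2)
  by (simp add: sub_subspace_def sub_dim_def)

lemma sub_dim_eq_iff:
  fixes h :: "'f::{field,finite} \<Rightarrow> 'a::{field,finite}" and U :: "('a ^ 'k::finite) set"
  assumes "field_hom h" "sub_subspace h U"
  shows "sub_dim h U = n \<longleftrightarrow> card U = CARD('f) ^ n"
  using card_sub_subspace[OF assms] card_field_ge_2[where 'f = 'f] by simp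

text \<open>Since \<open>w\<close> is nonzero, \<open>l \<mapsto> l *s w\<close> is a bijection from
  the scalars in question onto the intersection of \<open>U\<close> with the point.\<close>

lemma weight_span_singleton:
  fixes h :: "'f::{field,finite} \<Rightarrow> 'a::{field,finite}" and U :: "('a ^ 'k::finite) set"
  assumes h: "field_hom h" and U: "sub_subspace h U" and w: "w \<noteq> 0"
  shows "weight h U (vec.span {w}) = n \<longleftrightarrow> card {l. l *s w \<in> U} = CARD('f) ^ n"
proof -
  have eq: "U \<inter> vec.span {w} = (\<lambda>l. l *s w) ` {l. l *s w \<in> U}"
    by (auto simp: vec.span_singleton)
  have "inj (\<lambda>l. l *s w)"
    using w by (auto intro!: injI)
  then have card: "card (U \<inter> vec.span {w}) = card {l. l *s w \<in> U}"
    unfolding eq by (intro card_image) (auto intro: inj_on_subset)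
  have "sub_subspace h (U \<inter> vec.span {w})"
    using U by (auto simp: sub_subspace_iff[OF h] vec.span_zero vec.span_add vec.span_scale)
  then show ?thesis
    unfolding weight_def by (simp add: sub_dim_eq_iff[OF h] card)
qed

text \<open>The small field always occurs among the scalars \<open>l\<close> with
  \<open>l *s w \<in> U\<close>; weight one means that there are only \<open>q\<close> of them,
  hence no others.\<close>

lemma weight_eq_1_iff:
  fixes h :: "'f::{field,finite} \<Rightarrow> 'a::{field,finite}" and U :: "('a ^ 'k::finite) set"
  assumes h: "field_hom h" and U: "sub_subspace h U" and w: "w \<in> U" "w \<noteq> 0"
  shows "weight h U (vec.span {w}) = 1 \<longleftrightarrow> (\<forall>l. l *s w \<in> U \<longrightarrow> l \<in> range h)"
proof -
  have sub: "range h \<subseteq> {l. l *s w \<in> U}"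
    using U w(1) by (auto simp: sub_subspace_iff[OF h])
  have "card {l. l *s w \<in> U} = CARD('f) \<longleftrightarrow> {l. l *s w \<in> U} = range h"
    using card_subset_eq[OF _ sub] card_range_field_hom[OF h] by (metis finite)
  then show ?thesis
    using weight_span_singleton[OF h U w(2), of 1] sub by auto
qed

lemma scattered_scalar:
  fixes h :: "'f::{field,finite} \<Rightarrow> 'a::{field,finite}" and U :: "('a ^ 'k::finite) set"
  assumes "field_hom h" "scattered h U" "w \<in> U" "w \<noteq> 0" "l *s w \<in> U"
  shows "l \<in> range h"
  using assms weight_eq_1_iff[of h U w] unfolding scattered_def linear_set_def by blast

section \<open>Projective points, hyperplanes and values of polynomials\<close>

lemma span_singleton_eq:
  fixes u v :: "'a::field ^ 'k::finite"
  assumes "u \<in> vec.span {v}" "u \<noteq> 0"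
  shows "vec.span {u} = vec.span {v}"
proof -
  obtain c where c: "u = c *s v" using assms(1) by (auto simp: vec.span_singleton)
  then have "v = inverse c *s u" using assms(2) by auto
  then have "v \<in> vec.span {u}" by (metis vec.span_base vec.span_scale singletonI)
  then show ?thesis
    using assms(1) by (simp add: vec.span_eq)
qed

text \<open>Extend a basis of \<open>W\<close> by \<open>x\<close> and take a linear map that kills
  \<open>W\<close> and fixes \<open>x\<close>. The row of its matrix at a coordinate where
  \<open>x\<close> is nonzero is the desired equation.\<close>

lemma exists_separating_functional:
  fixes W :: "('a::field ^ 'k::finite) set"
  assumes W: "vec.subspace W" and x: "x \<notin> W"
  obtains c :: "'a ^ 'k"
  where "\<And>w. w \<in> W \<Longrightarrow> (\<Sum>j\<in>UNIV. c $ j * w $ j) = 0" "(\<Sum>j\<in>UNIV. c $ j * x $ j) \<noteq> 0"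
proof -
  obtain B where B: "B \<subseteq> W" "vec.independent B" "W \<subseteq> vec.span B"
    by (rule vec.basis_exists[of W])
  have span: "vec.span B = W"
    using B W by (simp add: vec.span_minimal subset_antisym)
  have "vec.independent (insert x B)"
    using B(2) x span by (simp add: vec.independent_insert)
  then obtain f where f: "Vector_Spaces.linear (*s) (*s) f"
      "\<forall>y\<in>insert x B. f y = (if y = x then x else 0)"
    using vec.linear_independent_extend[of "insert x B" "\<lambda>y. if y = x then x else 0"] by blast
  have fW: "f w = 0" if "w \<in> W" for w
    by (rule vec.linear_eq_0_on_span[OF f(1), of B]) (use f(2) B(1) x that span in auto)
  have "x \<noteq> 0"
    using x W vec.subspace_0 by blast
  then obtain l where l: "x $ l \<noteq> 0"
    by (auto simp: vec_eq_iff)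
  have eq: "(\<Sum>j\<in>UNIV. matrix f $ l $ j * w $ j) = f w $ l" for w
    using matrix_works[OF f(1), of w] by (auto simp: matrix_vector_mult_def vec_eq_iff)
  show ?thesis
    by (rule that[of "matrix f $ l"]) (use fW f(2) l in \<open>simp_all add: eq\<close>)
qed

text \<open>Each fibre over a value \<open>v\<close> is the root set of the nonzero polynomial
  \<open>p - [:v:]\<close>, so it has at most \<open>degree p\<close> elements; the fibres cover the
  field.\<close>

lemma card_field_le_card_range_poly:
  fixes p :: "'a::{field,finite} poly"
  assumes "degree p > 0"
  shows "CARD('a) \<le> card (range (poly p)) * degree p"
proof -
  have "card {x. poly p x = v} \<le> degree p" for v
  proof -
    have "coeff (p - [:v:]) (degree p) = lead_coeff p"
      using assms by (cases "degree p") simp_all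
    moreover have "lead_coeff p \<noteq> 0"
      using assms by auto
    ultimately have "p - [:v:] \<noteq> 0"
      by (metis coeff_0)
    from card_poly_roots_bound[OF this] show ?thesis
      using assms degree_diff_le[of p "degree p" "[:v:]"] by simp
  qed
  then have "(\<Sum>v\<in>range (poly p). card {x. poly p x = v}) \<le> card (range (poly p)) * degree p"
    using sum_bounded_above[of "range (poly p)" "\<lambda>v. card {x. poly p x = v}" "degree p"] by simp
  moreover have "CARD('a) \<le> (\<Sum>v\<in>range (poly p). card {x. poly p x = v})"
  proof -
    have "(\<Union>v\<in>range (poly p). {x. poly p x = v}) = UNIV" by auto
    then show ?thesis
      using card_UN_le[of "range (poly p)" "\<lambda>v. {x. poly p x = v}"] by simp
  qed
  ultimately show ?thesis by simp
qed

section \<open>The construction and its club property\<close>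

text \<open>Keeping \<open>x\<close> and \<open>z\<close> as separate arguments makes the vector
  linear in the pair over the small field; \<open>x = 0\<close> gives the vectors on the axis
  \<open>a\<close>.\<close>

definition club_vec :: "'k \<Rightarrow> 'k \<Rightarrow> 'k \<Rightarrow> nat \<Rightarrow> 'a::field \<Rightarrow> 'a \<Rightarrow> 'a ^ 'k" where
  "club_vec a b c q x z =
    (\<chi> j. if j = a then x + z else if j = b then x ^ q else if j = c then x ^ (q ^ 2) else 0)"

locale club =
  fixes h :: "'f::{field,finite} \<Rightarrow> 'a::{field,finite}" and a b c :: "'k::finite"
    and q :: nat and S :: "'a set" and U2 :: "('a ^ 'k) set"
  assumes h: "field_hom h"
    and q_def: "q = CARD('f)"
    and distinct: "a \<noteq> b" "a \<noteq> c" "b \<noteq> c"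
    and S: "module.subspace (\<lambda>c x. h c * x) S"
    and scattered: "scattered h U2"
    and U2_nth: "\<And>w. w \<in> U2 \<Longrightarrow> w $ a = 0 \<and> w $ b = 0 \<and> w $ c = 0"
begin

abbreviation V :: "'a \<Rightarrow> 'a \<Rightarrow> 'a ^ 'k" where
  "V \<equiv> club_vec a b c q"

definition U :: "('a ^ 'k) set" where
  "U = {V x z + w | x z w. z \<in> S \<and> w \<in> U2}"

lemma S_closed:
  "0 \<in> S" "z \<in> S \<Longrightarrow> z' \<in> S \<Longrightarrow> z + z' \<in> S" "z \<in> S \<Longrightarrow> h d * z \<in> S"
proof -
  interpret vector_space "\<lambda>c x. h c * x"
    by (rule vector_space_field_hom[OF h])
  show "0 \<in> S" "z \<in> S \<Longrightarrow> z' \<in> S \<Longrightarrow> z + z' \<in> S" "z \<in> S \<Longrightarrow> h d * z \<in> S"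
    using S by (auto simp: subspace_def)
qed

lemma U2_closed:
  "0 \<in> U2" "w \<in> U2 \<Longrightarrow> w' \<in> U2 \<Longrightarrow> w + w' \<in> U2" "w \<in> U2 \<Longrightarrow> h d *s w \<in> U2"
  using scattered by (auto simp: scattered_def sub_subspace_iff[OF h])

lemma q_ge_2: "q \<ge> 2"
  unfolding q_def by (rule card_field_ge_2)

lemma V_nth [simp]:
  "V x z $ a = x + z" "V x z $ b = x ^ q" "V x z $ c = x ^ (q ^ 2)"
  "j \<notin> {a, b, c} \<Longrightarrow> V x z $ j = 0"
  using distinct by (auto simp: club_vec_def)

lemma vec_eq_split:
  "u = v \<longleftrightarrow> u $ a = v $ a \<and> u $ b = v $ b \<and> u $ c = v $ c \<and> (\<forall>j. j \<notin> {a, b, c} \<longrightarrow> u $ j = v $ j)"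
  by (auto simp: vec_eq_iff)

lemma power_q2_add: "(x + y) ^ (q ^ 2) = x ^ (q ^ 2) + (y :: 'a) ^ (q ^ 2)"
  by (simp add: power2_eq_square power_mult power_card_add[OF h, folded q_def])

text \<open>By additivity, equal powers force \<open>(x - y) ^ q = 0\<close>.\<close>

lemma power_q_inj: "x ^ q = (y :: 'a) ^ q \<Longrightarrow> x = y"
  using power_card_add[OF h, folded q_def, of "x - y" y] q_ge_2 by simp

lemma V_add: "V (x + x') (z + z') = V x z + V x' z'"
  by (simp add: vec_eq_split power_card_add[OF h, folded q_def] power_q2_add)

lemma V_scale: "V (h d * x) (h d * z) = h d *s V x z"
  by (simp add: vec_eq_split power_mult_distrib power2_eq_square power_mult
      power_card_range_field_hom[OF h, folded q_def] distrib_left)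

lemma V_0 [simp]: "V 0 0 = 0"
  using q_ge_2 by (simp add: vec_eq_split)

lemma V_0_left: "V 0 z = z *s axis a 1"
  using q_ge_2 distinct by (simp add: vec_eq_split) (auto simp: axis_def)

lemma sub_subspace_U: "sub_subspace h U"
  unfolding sub_subspace_iff[OF h]
proof (intro conjI ballI allI)
  show "0 \<in> U"
    unfolding U_def using S_closed(1) U2_closed(1) V_0 by (metis (mono_tags, lifting) add_0 mem_Collect_eq)
  fix u assume "u \<in> U"
  then obtain x z w where u: "u = V x z + w" "z \<in> S" "w \<in> U2"
    by (auto simp: U_def)
  show "h d *s u \<in> U" for d
  proof -
    have "h d *s u = V (h d * x) (h d * z) + h d *s w"
      by (simp add: u(1) vec.scale_right_distrib V_scale)
    then show ?thesis
      using u S_closed(3) U2_closed(3) unfolding U_def by blast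
  qed
  fix v assume "v \<in> U"
  then obtain x' z' w' where v: "v = V x' z' + w'" "z' \<in> S" "w' \<in> U2"
    by (auto simp: U_def)
  have "u + v = V (x + x') (z + z') + (w + w')"
    by (simp add: u v V_add algebra_simps)
  then show "u + v \<in> U"
    using u v S_closed(2) U2_closed(2) unfolding U_def by blast
qed

text \<open>The representation \<open>V x z + w\<close> is unique: coordinate \<open>b\<close>
  determines \<open>x\<close>, then coordinate \<open>a\<close> determines \<open>z\<close>, and
  \<open>w\<close> is what remains.\<close>

lemma card_U: "card U = CARD('a) * card S * card U2"
proof -
  let ?f = "\<lambda>(x, z, w). V x z + w"
  have "inj_on ?f (UNIV \<times> S \<times> U2)"
  proof (rule inj_onI, clarsimp)
    fix x z w x' z' w'
    assume w: "w \<in> U2" "w' \<in> U2" and eq: "V x z + w = V x' z' + w'"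
    have x: "x = x'"
      using arg_cong[OF eq, of "\<lambda>v. v $ b"] U2_nth[OF w(1)] U2_nth[OF w(2)] by (simp add: power_q_inj)
    have z: "z = z'"
      using arg_cong[OF eq, of "\<lambda>v. v $ a"] U2_nth[OF w(1)] U2_nth[OF w(2)] x by simp
    show "x = x' \<and> z = z' \<and> w = w'"
      using x z eq by simp
  qed
  moreover have "U = ?f ` (UNIV \<times> S \<times> U2)"
    unfolding U_def by force
  ultimately show ?thesis
    by (simp add: card_image card_cartesian_product)
qed

lemma V_in_U: "z \<in> S \<Longrightarrow> V x z \<in> U"
  unfolding U_def using U2_closed(1) by force

lemma axis_scalars: "{l. l *s axis a 1 \<in> U} = S"
proof (intro equalityI subsetI; clarify?)
  fix l assume "l *s axis a 1 \<in> U"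
  then obtain x z w where u: "V 0 l = V x z + w" "z \<in> S" "w \<in> U2"
    by (auto simp: U_def V_0_left)
  have "x = 0"
    using arg_cong[OF u(1), of "\<lambda>v. v $ b"] U2_nth[OF u(3)] q_ge_2 by (simp add: power_0_left)
  then have "l = z"
    using arg_cong[OF u(1), of "\<lambda>v. v $ a"] U2_nth[OF u(3)] by simp
  then show "l \<in> S"
    using u(2) by simp
next
  show "l *s axis a 1 \<in> U" if "l \<in> S" for l
    using V_in_U[OF that, of 0] by (simp add: V_0_left)
qed

lemma scalar_in_small_field:
  assumes u: "u \<in> U" "u \<notin> vec.span {axis a 1}" and lu: "l *s u \<in> U"
  shows "l \<in> range h"
proof -
  obtain x z w where x: "u = V x z + w" "z \<in> S" "w \<in> U2"
    using u by (auto simp: U_def)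
  obtain x' z' w' where x': "l *s u = V x' z' + w'" "z' \<in> S" "w' \<in> U2"
    using lu by (auto simp: U_def)
  note nth = U2_nth[OF x(3)] U2_nth[OF x'(3)]
  have eq: "l * (V x z $ j + w $ j) = V x' z' $ j + w' $ j" for j
    using arg_cong[OF x'(1), of "\<lambda>v. v $ j"] x(1) by (simp add: distrib_left)
  show ?thesis
  proof (cases "w = 0")
    \<comment> \<open>Off the coordinates \<open>a\<close>, \<open>b\<close>, \<open>c\<close> the
      \<open>V\<close> parts vanish, and on them the \<open>U2\<close> parts do, so \<open>l\<close>
      carries \<open>w\<close> to \<open>w'\<close>.\<close>
    case False
    have "l *s w = w'"
      unfolding vec_eq_iff
    proof
      show "(l *s w) $ j = w' $ j" for j
        using nth eq[of j] V_nth(4)[of j] by (cases "j \<in> {a, b, c}") auto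
    qed
    then show ?thesis
      using scattered_scalar[OF h scattered x(3) False] x'(3) by simp
  next
    case True
    have x0: "x \<noteq> 0"
    proof
      assume "x = 0"
      then have "u = z *s axis a 1" using True x(1) by (simp add: V_0_left)
      then show False using u(2) by (auto simp: vec.span_singleton)
    qed
    \<comment> \<open>Coordinates \<open>b\<close> and \<open>c\<close> read
      \<open>l * x^q = x'^q\<close> and \<open>l * x^(q^2) = x'^(q^2)\<close>, so both powers of
      this quotient equal \<open>l\<close>.\<close>
    let ?t = "x' / x"
    have "?t ^ q = l"
      using eq[of b] nth x0 by (simp add: power_divide field_simps)
    moreover have "?t ^ (q ^ 2) = l"
      using eq[of c] nth x0 by (simp add: power_divide field_simps)
    ultimately have "l ^ q = l"
      by (metis power2_eq_square power_mult)
    then show ?thesis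
      by (simp add: power_card_eq_self_iff[OF h, folded q_def])
  qed
qed

lemma is_club_U:
  assumes "card S = q ^ i" "i \<ge> 1"
  shows "is_club h i U"
  unfolding is_club_def
proof (intro conjI bexI[of _ "vec.span {axis a 1}"] ballI impI)
  show "sub_subspace h U" by (rule sub_subspace_U)
  show "weight h U (vec.span {axis a 1}) = i"
    by (subst weight_span_singleton[OF h sub_subspace_U, folded q_def])
      (simp_all add: axis_scalars assms axis_eq_0_iff)
  \<comment> \<open>As \<open>i \<ge> 1\<close>, \<open>S\<close> has a nonzero element, so the axis
    really is a point of the linear set.\<close>
  have "q ^ 1 \<le> q ^ i"
    using assms(2) q_ge_2 by (intro power_increasing) auto
  then have "\<not> S \<subseteq> {0}"
    using assms(1) q_ge_2 card_mono[of "{0}" S] by auto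
  then obtain z where z: "z \<in> S" "z \<noteq> 0" by auto
  then have "z *s axis a 1 \<in> U - {0}"
    using axis_scalars by (auto simp: axis_eq_0_iff)
  moreover have "vec.span {z *s axis a 1} = vec.span {axis a 1}"
    using z by (intro span_singleton_eq) (auto simp: axis_eq_0_iff vec.span_singleton)
  ultimately show "vec.span {axis a 1} \<in> linear_set U"
    unfolding linear_set_def by blast
  fix Q assume "Q \<in> linear_set U" "Q \<noteq> vec.span {axis a 1}"
  then obtain u where u: "Q = vec.span {u}" "u \<in> U" "u \<noteq> 0" "u \<notin> vec.span {axis a 1}"
    unfolding linear_set_def using span_singleton_eq by blast
  show "weight h U Q = 1"
    unfolding u(1) weight_eq_1_iff[OF h sub_subspace_U u(2,3)]
    using scalar_in_small_field[OF u(2,4)] by blast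
qed

section \<open>The bound forced by an equivalence with a split club\<close>

text \<open>With \<open>card S = q ^ i\<close> and \<open>CARD('a) = q ^ m\<close> the conclusion
  reads \<open>m \<le> i + 2\<close>. The condition \<open>card U'' > q\<close> says that
  \<open>U''\<close> is too large to fit into a point of weight one.\<close>

lemma card_field_le_if_equivalent_split:
  fixes A :: "'a ^ 'k ^ 'k" and \<sigma> :: "'a \<Rightarrow> 'a"
  defines "\<phi> \<equiv> \<lambda>u. A *v (\<chi> j. \<sigma> (u $ j))"
  assumes A: "invertible A" and \<sigma>: "field_aut \<sigma>"
    and W: "vec.subspace W" "x \<notin> W"
    and U': "U' \<subseteq> W" "0 \<in> U'"
    and U'': "U'' \<subseteq> vec.span {x}" "0 \<in> U''" "card U'' > q"
    and split: "U' + U'' = \<phi> ` U"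
  shows "CARD('a) \<le> card S * q ^ 2"
proof -
  have \<sigma>h: "field_hom \<sigma>" and \<sigma>b: "bij \<sigma>"
    using \<sigma> by (auto simp: field_aut_def)
  note \<sigma>s = field_hom_simps[OF \<sigma>h] field_hom_diff[OF \<sigma>h] field_hom_power[OF \<sigma>h]
  obtain c' where c': "\<And>w. w \<in> W \<Longrightarrow> (\<Sum>j\<in>UNIV. c' $ j * w $ j) = 0"
      and c'x: "(\<Sum>j\<in>UNIV. c' $ j * x $ j) \<noteq> 0"
    using exists_separating_functional[OF W] by blast
  \<comment> \<open>\<open>d\<close> holds the coefficients of the separating equation pulled back
    through \<open>A\<close>; \<open>F\<close> also absorbs \<open>\<sigma>\<close>, so
    \<open>F u\<close> is the value of that equation at \<open>\<phi> u\<close>.\<close>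
  define d where "d = c' v* A"
  define F where "F u = (\<Sum>j\<in>UNIV. d $ j * \<sigma> (u $ j))" for u :: "'a ^ 'k"
  have F: "(\<Sum>j\<in>UNIV. c' $ j * \<phi> u $ j) = F u" for u
  proof -
    have "(\<Sum>j\<in>UNIV. c' $ j * \<phi> u $ j) = (\<Sum>j\<in>UNIV. \<Sum>l\<in>UNIV. c' $ j * A $ j $ l * \<sigma> (u $ l))"
      by (simp add: \<phi>_def matrix_vector_mult_def sum_distrib_left mult.assoc)
    also have "\<dots> = (\<Sum>l\<in>UNIV. \<Sum>j\<in>UNIV. c' $ j * A $ j $ l * \<sigma> (u $ l))"
      by (rule sum.swap)
    also have "\<dots> = F u"
      by (simp add: F_def d_def vector_matrix_mult_def sum_distrib_right mult.assoc)
    finally show ?thesis .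
  qed
  have F_V: "F (V y z) = d $ a * \<sigma> (y + z) + d $ b * \<sigma> y ^ q + d $ c * \<sigma> y ^ (q ^ 2)" for y z
  proof -
    have "F (V y z) = (\<Sum>j\<in>{a, b, c}. d $ j * \<sigma> (V y z $ j))"
      unfolding F_def by (intro sum.mono_neutral_right) (auto simp: \<sigma>s)
    then show ?thesis
      using distinct by (simp add: \<sigma>s algebra_simps)
  qed
  have \<phi>_scale: "\<phi> (l *s u) = \<sigma> l *s \<phi> u" for l u
  proof -
    have "(\<chi> j. \<sigma> ((l *s u) $ j)) = \<sigma> l *s (\<chi> j. \<sigma> (u $ j))"
      by (simp add: vec_eq_iff \<sigma>s)
    then show ?thesis
      by (simp add: \<phi>_def vector_scalar_commute)
  qed
  have \<phi>_inj: "u = v" if "\<phi> u = \<phi> v" for u v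
  proof -
    have "(\<chi> j. \<sigma> (u $ j)) = (\<chi> j. \<sigma> (v $ j))"
      using that unfolding \<phi>_def by (rule injD[OF inj_matrix_vector_mult[OF A]])
    then show ?thesis
      using bij_is_inj[OF \<sigma>b] by (simp add: vec_eq_iff inj_eq)
  qed
  have \<phi>_0: "\<phi> 0 = 0"
    using \<phi>_scale[of 0 0] by (simp add: \<sigma>s)
  have U''_sub: "y \<in> \<phi> ` U" if "y \<in> U''" for y
    using set_plus_intro[OF U'(2) that] split by simp

  \<comment> \<open>All points of \<open>U\<close> other than the one spanned by \<open>axis a 1\<close> are too light to be mapped
    onto the point containing \<open>U''\<close>.\<close>
  have preimage: "\<exists>z\<in>S. v = V 0 z" if v: "v \<in> U" "\<phi> v \<in> U''" for v
  proof -
    have "v \<in> vec.span {axis a 1}"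
    proof (rule ccontr)
      assume nv: "v \<notin> vec.span {axis a 1}"
      then have "v \<noteq> 0" using vec.span_zero by blast
      then have "\<phi> v \<noteq> 0" using \<phi>_inj[of v 0] \<phi>_0 by auto
      then have span: "vec.span {\<phi> v} = vec.span {x}"
        using v(2) U''(1) by (intro span_singleton_eq) auto
      \<comment> \<open>Every element of \<open>U''\<close> is a multiple of
        \<open>\<phi> v\<close>, hence the image of some \<open>l *s v\<close> in \<open>U\<close>;
        since \<open>v\<close> is off the axis, \<open>l\<close> lies in the small field. This
        leaves at most \<open>q\<close> elements.\<close>
      have "U'' \<subseteq> (\<lambda>l. \<phi> (l *s v)) ` range h"
      proof
        fix y assume y: "y \<in> U''"
        then obtain u where u: "y = \<phi> u" "u \<in> U" using U''_sub by blast
        have "y \<in> vec.span {\<phi> v}"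
          using y U''(1) span by blast
        then obtain l' where "y = l' *s \<phi> v"
          by (auto simp: vec.span_singleton)
        then obtain l where "y = \<phi> (l *s v)"
          using bij_is_surj[OF \<sigma>b] \<phi>_scale by (metis surjD)
        then show "y \<in> (\<lambda>l. \<phi> (l *s v)) ` range h"
          using scalar_in_small_field[OF v(1) nv] u \<phi>_inj by blast
      qed
      then have "card U'' \<le> card (range h)"
        by (meson card_image_le card_mono finite order.trans)
      then show False
        using U''(3) card_range_field_hom[OF h, folded q_def] by simp
    qed
    then obtain z where "v = z *s axis a 1"
      by (auto simp: vec.span_singleton)
    then show ?thesis
      using v(1) axis_scalars by (auto simp: V_0_left)
  qed

  \<comment> \<open>Otherwise \<open>F\<close> would vanish on the axis, which contains the
    preimages of \<open>U''\<close>, and the equation would vanish at a nonzero multiple of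
    \<open>x\<close>.\<close>
  have da: "d $ a \<noteq> 0"
  proof
    assume "d $ a = 0"
    have "\<not> U'' \<subseteq> {0}"
      using U''(3) q_ge_2 card_mono[of "{0}" U''] by auto
    then obtain y where y: "y \<in> U''" "y \<noteq> 0" by auto
    have "y \<in> vec.span {x}"
      using y U''(1) by blast
    then obtain s where s: "y = s *s x" "s \<noteq> 0"
      using y(2) by (auto simp: vec.span_singleton)
    obtain v where v: "v \<in> U" "y = \<phi> v" using U''_sub[OF y(1)] by blast
    then obtain z where "v = V 0 z" using preimage y(1) by blast
    then have "(\<Sum>j\<in>UNIV. c' $ j * y $ j) = 0"
      using \<open>d $ a = 0\<close> q_ge_2 by (simp add: v F F_V \<sigma>s power_0_left)
    moreover have "(\<Sum>j\<in>UNIV. c' $ j * y $ j) = s * (\<Sum>j\<in>UNIV. c' $ j * x $ j)"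
      by (simp add: s sum_distrib_left mult_ac)
    ultimately show False
      using s c'x by simp
  qed

  \<comment> \<open>Chosen so that \<open>F (V y' 0)\<close> is the value of \<open>p\<close> at
    \<open>\<sigma> y'\<close>, because \<open>\<sigma>\<close> commutes with powers.\<close>
  define p where "p = monom (d $ a) 1 + monom (d $ b) q + monom (d $ c) (q ^ 2)"
  have poly_p: "poly p y = d $ a * y + d $ b * y ^ q + d $ c * y ^ (q ^ 2)" for y
    by (simp add: p_def poly_monom)
  have q2: "q \<le> q ^ 2" by (simp add: power2_eq_square)
  have "degree p \<le> q ^ 2"
    unfolding p_def using q2 q_ge_2
    by (intro degree_add_le order.trans[OF degree_monom_le]) auto
  \<comment> \<open>Since \<open>q \<ge> 2\<close>, the other two monomials do not reach exponent
    one, and \<open>p\<close> is not constant.\<close>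
  moreover have "coeff p 1 = d $ a"
    using q_ge_2 by (simp add: p_def power2_eq_square)
  then have "degree p \<ge> 1"
    using da by (metis le_degree)
  \<comment> \<open>Split \<open>\<phi> (V y' 0)\<close> along \<open>U' + U''\<close>: the equation
    kills the first summand, and the second comes from some \<open>V 0 z\<close> with
    \<open>z \<in> S\<close>.\<close>
  moreover have "range (poly p) \<subseteq> (\<lambda>z. d $ a * \<sigma> z) ` S"
  proof clarify
    fix y
    obtain y' where y': "y = \<sigma> y'" using bij_is_surj[OF \<sigma>b] by (metis surjD)
    have "\<phi> (V y' 0) \<in> U' + U''"
      using V_in_U[OF S_closed(1)] split by blast
    then obtain u' u'' where u: "\<phi> (V y' 0) = u' + u''" "u' \<in> U'" "u'' \<in> U''"
      by (auto elim: set_plus_elim)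
    obtain v where v: "v \<in> U" "u'' = \<phi> v" using U''_sub[OF u(3)] by blast
    then obtain z where z: "z \<in> S" "v = V 0 z" using preimage u(3) by blast
    have "F (V y' 0) = (\<Sum>j\<in>UNIV. c' $ j * u' $ j) + F v"
      by (simp add: F[symmetric] u(1) v(2)[symmetric] distrib_left sum.distrib)
    also have "(\<Sum>j\<in>UNIV. c' $ j * u' $ j) = 0"
      using c' u(2) U'(1) by blast
    finally have "poly p y = d $ a * \<sigma> z"
      using q_ge_2 by (simp add: poly_p F_V z(2) y' \<sigma>s power_0_left)
    then show "poly p y \<in> (\<lambda>z. d $ a * \<sigma> z) ` S"
      using z(1) by blast
  qed
  then have "card (range (poly p)) \<le> card S"
    by (meson card_image_le card_mono finite order.trans)
  ultimately show ?thesis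
    using card_field_le_card_range_poly[of p]
      mult_le_mono[of "card (range (poly p))" "card S" "degree p" "q ^ 2"]
    by linarith
qed

end

section \<open>Rank, club property and inequivalence combined\<close>

theorem theorem5p17:
  fixes h :: "'f::{field,finite} \<Rightarrow> 'a::{field,finite}"
    and e :: "nat \<Rightarrow> 'k::finite"
    and q m k i :: nat
    and S :: "'a set"
    and U1 U2 :: "('a ^ 'k) set"
  assumes h: "field_hom h"
    and q: "CARD('f) = q"
    and qm: "CARD('a) = q ^ m"
    and k: "CARD('k) = k" "k \<ge> 6" "even k"
    and m: "m > 0" "even m"
    and e: "bij_betw e {..<k} UNIV"
    and S: "module.subspace (\<lambda>c x. h c * x) S" "vector_space.dim (\<lambda>c x. h c * x) S = i"
    and i: "i \<ge> 1"
    and U1: "U1 = {\<chi> j. if j = e 0 then x + \<zeta> else if j = e 1 then x ^ q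
                         else if j = e 2 then x ^ (q ^ 2) else 0 | x \<zeta>. \<zeta> \<in> S}"
    and U2: "max_scattered_in h m {v. v $ e 0 = 0 \<and> v $ e 1 = 0 \<and> v $ e 2 = 0} U2"
  shows "is_club h i (U1 + U2) \<and>
         sub_dim h (U1 + U2) = m * (k - 1) div 2 + i \<and>
         (m \<le> 2 * i \<and> i + 3 \<le> m \<longrightarrow>
           \<not> (\<exists>W U' U'' x.
                vec.subspace W \<and> vec.dim W = k - 1 \<and> max_scattered_in h m W U' \<and>
                sub_subspace h U'' \<and> U'' \<subseteq> vec.span {x} \<and> sub_dim h U'' = i \<and>
                vec.span {x} \<inter> W = {0} \<and>
                is_club h i (U' + U'') \<and>
                GammaL_equivalent (U1 + U2) (U' + U'')))"
proof -
  have inj: "e s = e t \<longleftrightarrow> s = t" if "s < k" "t < k" for s t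
    using e that by (auto simp: bij_betw_def inj_on_def)
  have distinct: "e 0 \<noteq> e 1" "e 0 \<noteq> e 2" "e 1 \<noteq> e 2"
    using k(2) by (auto simp: inj)
  interpret C: club h "e 0" "e 1" "e 2" q S U2
    using h q distinct S(1) U2 by unfold_locales (auto simp: max_scattered_in_def)
  have U: "U1 + U2 = C.U"
    unfolding U1 C.U_def club_vec_def by (auto simp: set_plus_def)
  have cardS: "card S = q ^ i"
    using vector_space.card_subspace[OF vector_space_field_hom[OF h] S(1)] S(2) q by simp
  \<comment> \<open>Rewritten as a coordinate subspace, whose dimension is the number of free
    coordinates.\<close>
  have "{v :: 'a ^ 'k. v $ e 0 = 0 \<and> v $ e 1 = 0 \<and> v $ e 2 = 0}
      = {v. \<forall>j. j \<notin> - {e 0, e 1, e 2} \<longrightarrow> v $ j = 0}"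
    by auto
  then have "vec.dim {v :: 'a ^ 'k. v $ e 0 = 0 \<and> v $ e 1 = 0 \<and> v $ e 2 = 0} = k - 3"
    using distinct k(1) by (simp only: dim_substandard_cart) (simp add: Compl_eq_Diff_UNIV card_Diff_subset)
  then have dimU2: "2 * sub_dim h U2 = (k - 3) * m"
    using U2 by (simp add: max_scattered_in_def)
  have "card C.U = q ^ m * q ^ i * q ^ sub_dim h U2"
    using C.card_U card_sub_subspace[OF h, of U2] C.scattered by (simp add: q qm cardS scattered_def)
  also have "\<dots> = q ^ (m + i + sub_dim h U2)"
    by (simp add: power_add)
  also have "m + i + sub_dim h U2 = m * (k - 1) div 2 + i"
  proof -
    \<comment> \<open>Here \<open>(k - 1) * m = 2 * m + (k - 3) * m\<close>, so the division by two
      is exact.\<close>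
    have "m * (k - 1) = 2 * (m + sub_dim h U2)"
      using dimU2 k(2) by (simp add: algebra_simps diff_mult_distrib2)
    then show ?thesis by simp
  qed
  finally have dimU: "sub_dim h C.U = m * (k - 1) div 2 + i"
    using sub_dim_eq_iff[OF h C.sub_subspace_U] q by simp
  have False
    if i': "m \<le> 2 * i" "i + 3 \<le> m" and W: "vec.subspace W" "max_scattered_in h m W U'"
      and U'': "sub_subspace h U''" "U'' \<subseteq> vec.span {x}" "sub_dim h U'' = i"
      and x: "vec.span {x} \<inter> W = {0}" and equiv: "GammaL_equivalent C.U (U' + U'')"
    for W U' U'' x
  proof -
    obtain A \<sigma> where A: "invertible A" "field_aut \<sigma>"
        and split: "U' + U'' = (\<lambda>u. A *v (\<chi> j. \<sigma> (u $ j))) ` C.U"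
      using equiv by (auto simp: GammaL_equivalent_def)
    \<comment> \<open>The two bounds on \<open>i\<close> give \<open>i + 3 \<le> 2 * i\<close>, so
      \<open>i \<ge> 3\<close>.\<close>
    have "q ^ 1 < q ^ i"
      using i' C.q_ge_2 by (intro power_strict_increasing) auto
    then have card: "card U'' > q"
      using card_sub_subspace[OF h U''(1)] U''(3) q by simp
    have "x \<noteq> 0"
    proof
      assume "x = 0"
      then have "card U'' \<le> 1" using U''(2) card_mono[of "{0}" U''] by simp
      then show False using card C.q_ge_2 by simp
    qed
    then have "x \<notin> W" using x vec.span_base[of x "{x}"] by auto
    moreover have "U' \<subseteq> W" "0 \<in> U'" "0 \<in> U''"
      using W(2) U''(1) by (auto simp: max_scattered_in_def scattered_def sub_subspace_iff[OF h])
    ultimately have "q ^ m \<le> q ^ i * q ^ 2"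
      using C.card_field_le_if_equivalent_split[OF A W(1) _ _ _ U''(2) _ card split] by (simp add: cardS qm)
    then have "q ^ m \<le> q ^ (i + 2)"
      by (simp only: power_add)
    then have "m \<le> i + 2"
      by (rule power_le_imp_le_exp[rotated]) (use C.q_ge_2 in simp)
    then show False
      using i' by simp
  qed
  then show ?thesis
    unfolding U using C.is_club_U[OF _ i] cardS dimU by auto
qed

end
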